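(* Let $\widetilde{\mathcal Z}$ be a Euclidean zero-set with finite area. Then for all $\alpha\in[0,1]$, $$\widetilde\gamma_{\rm thin}(\widetilde{\mathcal Z})\big((1-\alpha)-2(1-\alpha)^2\big)\le\widetilde I(\alpha,\alpha,\widetilde{\mathcal Z})\le\widetilde\gamma_{\rm thin}(\widetilde{\mathcal Z})(1-\alpha).$$ Furthermore, $\widetilde I(\alpha,\alpha,\widetilde{\mathcal Z})=(1-\alpha)\widetilde\gamma(\widetilde{\mathcal Z})$ for all $\alpha\in[0,1]$ if and only if $\widetilde\gamma_{\rm thin}(\widetilde{\mathcal Z})=\widetilde\gamma(\widetilde{\mathcal Z})$.
   Context: $\widetilde R_{a,b}=[0,a]\times[0,b]$. A Euclidean zero-set is a closed $\widetilde{\mathcal Z}\subseteq[0,\infty)^2$ such that $(a,b)\in\widetilde{\mathcal Z}$ implies $\widetilde R_{a,b}\subseteq\widetilde{\mathcal Z}$, and $\widetilde{\mathcal Z}$ is the closure of $\widetilde{\mathcal Z}\cap(0,\infty)^2$. For Borel $A\subseteq[0,\infty)^2$, $\widetilde{\mathrm{row}}(x,A)$ (resp. $\widetilde{\mathrm{col}}(x,A)$) is the 1-dimensional Lebesgue measure of $A$ intersected with the horizontal (resp. vertical) line through $x$. For left-continuous nonincreasing $f,g:[0,\infty)\to[0,\infty)$ of compact support, $\widetilde{\mathcal T}(A)=A\cup\{(u,v):(\widetilde{\mathrm{row}}((u,v),A)+f(v),\widetilde{\mathrm{col}}((u,v),A)+g(u))\notin\widetilde{\mathcal Z}\}$; $A$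 E-spans for $(\widetilde{\mathcal Z},f,g)$ if $\bigcup_n\widetilde{\mathcal T}^n(A)=[0,\infty)^2$. For bounded $\widetilde{\mathcal Z}$ and $(\alpha,\beta)\in[0,1]^2$: $\widetilde I(\alpha,\beta,\widetilde{\mathcal Z})=\inf\{\mathrm{area}(A)+(1-\alpha)\int_0^\infty f+(1-\beta)\int_0^\infty g\}$ over all $(A,f,g)$ with $A$ compact E-spanning for $(\widetilde{\mathcal Z},f,g)$; $\widetilde\gamma_{\rm thin}(\widetilde{\mathcal Z})=\inf\{\int f+\int g:\emptyset\text{ E-spans for }(\widetilde{\mathcal Z},f,g)\}$. For general $\widetilde{\mathcal Z}$ both are defined as $\lim_{R\to\infty}$ of the values for $\widetilde{\mathcal Z}\cap[0,R]^2$. $\widetilde\gamma(\widetilde{\mathcal Z})=\widetilde I(0,0,\widetilde{\mathcal Z})$. *)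

theory Defs
  imports "HOL-Analysis.Analysis"
begin

type_synonym pt = "real \<times> real"

definition quadrant :: "pt set" where
  "quadrant = {p. fst p \<ge> 0 \<and> snd p \<ge> 0}"

definition rect :: "real \<Rightarrow> real \<Rightarrow> pt set" where
  "rect a b = {0..a} \<times> {0..b}"

definition euclid_zero_set :: "pt set \<Rightarrow> bool" where
  "euclid_zero_set Z \<longleftrightarrow> closed Z \<and> Z \<subseteq> quadrant
     \<and> (\<forall>a b. (a, b) \<in> Z \<longrightarrow> rect a b \<subseteq> Z)
     \<and> Z = closure (Z \<inter> {p. fst p > 0 \<and> snd p > 0})"

definition row :: "pt \<Rightarrow> pt set \<Rightarrow> ennreal" where
  "row p A = emeasure lebesgue {x. (x, snd p) \<in> A}"

definition col :: "pt \<Rightarrow> pt set \<Rightarrow> ennreal" where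
  "col p A = emeasure lebesgue {y. (fst p, y) \<in> A}"

definition notin_Z :: "pt set \<Rightarrow> ennreal \<Rightarrow> ennreal \<Rightarrow> bool" where
  "notin_Z Z r c \<longleftrightarrow> r = \<infinity> \<or> c = \<infinity> \<or> (enn2real r, enn2real c) \<notin> Z"

definition admissible :: "(real \<Rightarrow> real) \<Rightarrow> bool" where
  "admissible f \<longleftrightarrow> (\<forall>x\<ge>0. f x \<ge> 0) \<and> (\<forall>x<0. f x = 0)
     \<and> (\<forall>x y. 0 \<le> x \<longrightarrow> x \<le> y \<longrightarrow> f y \<le> f x)
     \<and> (\<forall>x>0. continuous (at_left x) f)
     \<and> (\<exists>M. \<forall>x\<ge>M. f x = 0)"

definition Top :: "pt set \<Rightarrow> (real \<Rightarrow> real) \<Rightarrow> (real \<Rightarrow> real) \<Rightarrow> pt set \<Rightarrow> pt set" where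
  "Top Z f g A = A \<union> {(u, v). u \<ge> 0 \<and> v \<ge> 0 \<and>
      notin_Z Z (row (u, v) A + ennreal (f v)) (col (u, v) A + ennreal (g u))}"

definition espans :: "pt set \<Rightarrow> (real \<Rightarrow> real) \<Rightarrow> (real \<Rightarrow> real) \<Rightarrow> pt set \<Rightarrow> bool" where
  "espans Z f g A \<longleftrightarrow> (\<Union>n. (Top Z f g ^^ n) A) = quadrant"

definition I_bdd :: "real \<Rightarrow> real \<Rightarrow> pt set \<Rightarrow> real" where
  "I_bdd \<alpha> \<beta> Z = Inf {measure lborel A + (1 - \<alpha>) * integral {0..} f + (1 - \<beta>) * integral {0..} g
      | A f g. compact A \<and> A \<subseteq> quadrant \<and> admissible f \<and> admissible g \<and> espans Z f g A}"

definition gamma_thin_bdd :: "pt set \<Rightarrow> real" where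
  "gamma_thin_bdd Z = Inf {integral {0..} f + integral {0..} g
      | f g. admissible f \<and> admissible g \<and> espans Z f g {}}"

definition I_E :: "real \<Rightarrow> real \<Rightarrow> pt set \<Rightarrow> real" where
  "I_E \<alpha> \<beta> Z = Lim at_top (\<lambda>R. I_bdd \<alpha> \<beta> (Z \<inter> rect R R))"

definition gamma_thin_E :: "pt set \<Rightarrow> real" where
  "gamma_thin_E Z = Lim at_top (\<lambda>R. gamma_thin_bdd (Z \<inter> rect R R))"

definition gamma_E :: "pt set \<Rightarrow> real" where
  "gamma_E Z = I_E 0 0 Z"

end

theory Submission
  imports Defs
begin

text \<open>
  If \<open>A\<close> E-spans for \<open>(Z, f, g)\<close>, then the empty set E-spans after \<open>f\<close> and \<open>g\<close> are increased by the
  row and column measures of \<open>A\<close>, which costs \<open>2 area(A)\<close>. The increased functions are no longer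
  monotone, but the dynamics from the empty set sees them only through the measures of their
  superlevel sets, so decreasing rearrangement makes them admissible. Hence
  \<open>\<gamma>\<^sub>t\<^sub>h\<^sub>i\<^sub>n \<le> \<integral>f + \<integral>g + 2 area(A)\<close>, and therefore \<open>I(\<alpha>, \<alpha>) \<ge> (1 - \<alpha>) \<gamma>\<^sub>t\<^sub>h\<^sub>i\<^sub>n\<close> as soon as
  \<open>\<alpha> \<ge> 1/2\<close>; for smaller \<open>\<alpha>\<close> the lower bound of the theorem is nonpositive. The limits over the
  truncations of \<open>Z\<close> exist by monotonicity and the bound of \<open>\<gamma>\<^sub>t\<^sub>h\<^sub>i\<^sub>n\<close> by the area of \<open>Z\<close>.
\<close>

section \<open>Measurability and monotonicity of the dynamics\<close>

text \<open>The shape in which a zero-set enters the dynamics. Unlike the closure clause of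
  \<open>euclid_zero_set\<close>, it passes to \<open>Z \<inter> rect R R\<close> for every real
  \<open>R\<close>, also for \<open>R = 0\<close>.\<close>

definition lower_set :: "pt set \<Rightarrow> bool" where
  "lower_set Z \<longleftrightarrow> Z \<subseteq> quadrant \<and> (\<forall>a b. (a, b) \<in> Z \<longrightarrow> rect a b \<subseteq> Z)"

text \<open>Within the quadrant the complement of a lower set is closed upwards. Infinite measures
  count as outside, so the rectangle property is applied to finite values only.\<close>

lemma notin_Z_mono:
  assumes "lower_set Z" "r \<le> r'" "c \<le> c'" "notin_Z Z r c"
  shows "notin_Z Z r' c'"
proof (cases "r' = \<infinity> \<or> c' = \<infinity>")
  case True
  then show ?thesis by (auto simp: notin_Z_def)
next
  case False
  then have fin: "r \<noteq> \<infinity>" "c \<noteq> \<infinity>" "r' < top" "c' < top"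
    using assms(2,3) by (auto simp: less_top top_unique)
  have "(enn2real r, enn2real c) \<in> rect (enn2real r') (enn2real c')"
    using assms(2,3) fin by (auto simp: rect_def intro!: enn2real_mono)
  then show ?thesis
    using assms(1,4) fin unfolding notin_Z_def lower_set_def by blast
qed

lemma notin_Z_antimono:
  assumes "Z1 \<subseteq> Z2" "notin_Z Z2 r c"
  shows "notin_Z Z1 r c"
  using assms by (auto simp: notin_Z_def)

section \<open>Borel sections, row and column measures, and Tonelli\<close>

lemma sets_section_fst:
  fixes A :: "pt set"
  assumes "A \<in> sets borel"
  shows "{x. (x, v) \<in> A} \<in> sets borel"
proof -
  have "(\<lambda>x. (x, v)) -` A \<inter> space borel \<in> sets borel"
    using assms by (intro measurable_sets[of _ borel borel]) auto
  then show ?thesis by (simp add: vimage_def)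
qed

lemma sets_section_snd:
  fixes A :: "pt set"
  assumes "A \<in> sets borel"
  shows "{y. (u, y) \<in> A} \<in> sets borel"
proof -
  have "(\<lambda>x. (u, x)) -` A \<inter> space borel \<in> sets borel"
    using assms by (intro measurable_sets[of _ borel borel]) auto
  then show ?thesis by (simp add: vimage_def)
qed

lemma row_eq_lborel: "A \<in> sets borel \<Longrightarrow> row p A = emeasure lborel {x. (x, snd p) \<in> A}"
  by (simp add: row_def sets_section_fst)

lemma col_eq_lborel: "A \<in> sets borel \<Longrightarrow> col p A = emeasure lborel {y. (fst p, y) \<in> A}"
  by (simp add: col_def sets_section_snd)

text \<open>The outer set must be Borel, because a nonmeasurable section has \<open>emeasure\<close> 0; the inner
  one need not be.\<close>

lemma row_mono: "A \<subseteq> B \<Longrightarrow> B \<in> sets borel \<Longrightarrow> row p A \<le> row p B"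
  unfolding row_def by (rule emeasure_mono) (auto simp: sets_section_fst sets_completionI_sets)

lemma col_mono: "A \<subseteq> B \<Longrightarrow> B \<in> sets borel \<Longrightarrow> col p A \<le> col p B"
  unfolding col_def by (rule emeasure_mono) (auto simp: sets_section_snd sets_completionI_sets)

lemma measurable_row:
  assumes "A \<in> sets borel"
  shows "(\<lambda>v. row (u, v) A) \<in> borel_measurable borel"
proof -
  have A: "A \<in> sets (lborel \<Otimes>\<^sub>M lborel)"
    using assms unfolding lborel_prod by simp
  have "(\<lambda>v. row (u, v) A) = (\<lambda>v. emeasure lborel ((\<lambda>x. (x, v)) -` A))"
    using assms by (simp add: row_eq_lborel vimage_def)
  then show ?thesis
    using lborel_pair.measurable_emeasure_Pair2[OF A] by simp
qed

lemma measurable_col: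
  assumes "A \<in> sets borel"
  shows "(\<lambda>u. col (u, v) A) \<in> borel_measurable borel"
proof -
  have A: "A \<in> sets (lborel \<Otimes>\<^sub>M lborel)"
    using assms unfolding lborel_prod by simp
  have "(\<lambda>u. col (u, v) A) = (\<lambda>u. emeasure lborel (Pair u -` A))"
    using assms by (simp add: col_eq_lborel vimage_def)
  then show ?thesis
    using lborel.measurable_emeasure_Pair[OF A] by simp
qed

lemma nn_integral_row:
  assumes "A \<in> sets borel"
  shows "(\<integral>\<^sup>+v. row (u, v) A \<partial>lborel) = emeasure lborel A"
proof -
  have A: "A \<in> sets (lborel \<Otimes>\<^sub>M lborel)"
    using assms unfolding lborel_prod by simp
  show ?thesis
    using lborel_pair.emeasure_pair_measure_alt2[OF A] assms
    by (simp add: row_eq_lborel vimage_def lborel_prod)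
qed

lemma nn_integral_col:
  assumes "A \<in> sets borel"
  shows "(\<integral>\<^sup>+u. col (u, v) A \<partial>lborel) = emeasure lborel A"
proof -
  have A: "A \<in> sets (lborel \<Otimes>\<^sub>M lborel)"
    using assms unfolding lborel_prod by simp
  show ?thesis
    using lborel.emeasure_pair_measure_alt[OF A] assms
    by (simp add: col_eq_lborel vimage_def lborel_prod)
qed

lemma mem_Top_iff:
  "(u, v) \<in> Top Z f g A \<longleftrightarrow> (u, v) \<in> A \<or>
    0 \<le> u \<and> 0 \<le> v \<and> notin_Z Z (row (u, v) A + ennreal (f v)) (col (u, v) A + ennreal (g u))"
  by (simp add: Top_def)

lemma borel_Top:
  assumes "closed Z" "A \<in> sets borel" "f \<in> borel_measurable borel" "g \<in> borel_measurable borel"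
  shows "Top Z f g A \<in> sets borel"
proof -
  \<comment> \<open>A row measure depends on the height alone and a column measure on the abscissa
    alone. Fixing the other coordinate at 0 makes each a measurable function of one variable,
    composed with a projection.\<close>
  have r [measurable]: "(\<lambda>v. row (0, v) A) \<in> borel_measurable borel"
    by (rule measurable_row[OF assms(2)])
  have c [measurable]: "(\<lambda>u. col (u, 0) A) \<in> borel_measurable borel"
    by (rule measurable_col[OF assms(2)])
  note [measurable] = assms(3,4) borel_closed[OF assms(1)]
  define B where "B = {p::pt. 0 \<le> fst p \<and> 0 \<le> snd p \<and>
    (row (0, snd p) A + ennreal (f (snd p)) = \<infinity> \<or> col (fst p, 0) A + ennreal (g (fst p)) = \<infinity> \<or>
     (enn2real (row (0, snd p) A + ennreal (f (snd p))),
      enn2real (col (fst p, 0) A + ennreal (g (fst p)))) \<notin> Z)}"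
  have "B = {p \<in> space (borel \<Otimes>\<^sub>M borel). 0 \<le> fst p \<and> 0 \<le> snd p \<and>
    (row (0, snd p) A + ennreal (f (snd p)) = \<infinity> \<or> col (fst p, 0) A + ennreal (g (fst p)) = \<infinity> \<or>
     (enn2real (row (0, snd p) A + ennreal (f (snd p))),
      enn2real (col (fst p, 0) A + ennreal (g (fst p)))) \<notin> Z)}"
    by (simp add: B_def space_pair_measure)
  also have "\<dots> \<in> sets (borel \<Otimes>\<^sub>M borel)"
    by measurable
  finally have "B \<in> sets borel"
    unfolding borel_prod .
  moreover have "Top Z f g A = A \<union> B"
    by (auto simp: Top_def B_def notin_Z_def row_def col_def)
  ultimately show ?thesis using assms(2) by auto
qed

lemma borel_Top_funpow:
  assumes "closed Z" "A \<in> sets borel" "f \<in> borel_measurable borel" "g \<in> borel_measurable borel"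
  shows "(Top Z f g ^^ n) A \<in> sets borel"
  using assms by (induction n) (auto intro: borel_Top)

text \<open>A larger infected set and a smaller zero-set both make it easier to leave the zero-set.
  \<open>A2\<close> is Borel for the sake of \<open>row_mono\<close> and
  \<open>col_mono\<close>.\<close>

lemma Top_mono_antimono:
  assumes "lower_set Z1" "Z1 \<subseteq> Z2" "A1 \<subseteq> A2" "A2 \<in> sets borel"
  shows "Top Z2 f g A1 \<subseteq> Top Z1 f g A2"
proof -
  have "notin_Z Z1 (row p A2 + ennreal (f v)) (col p A2 + ennreal (g u))"
    if "notin_Z Z2 (row p A1 + ennreal (f v)) (col p A1 + ennreal (g u))" for p u v
    using notin_Z_mono[OF assms(1) _ _ notin_Z_antimono[OF assms(2) that]]
      row_mono[OF assms(3,4)] col_mono[OF assms(3,4)] by (simp add: add_right_mono)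
  then show ?thesis using assms(3) by (auto simp: Top_def)
qed

lemma Top_subset_quadrant: "A \<subseteq> quadrant \<Longrightarrow> Top Z f g A \<subseteq> quadrant"
  by (auto simp: Top_def quadrant_def)

lemma Top_funpow_subset_quadrant: "A \<subseteq> quadrant \<Longrightarrow> (Top Z f g ^^ n) A \<subseteq> quadrant"
  by (induction n) (auto dest: Top_subset_quadrant)

text \<open>Serves to show that the infima increase with the truncation radius: whatever spans for a
  large truncation competes in the infimum for a smaller one.\<close>

lemma espans_antimono:
  assumes "lower_set Z1" "Z1 \<subseteq> Z2" "closed Z1" "A \<in> sets borel" "A \<subseteq> quadrant"
    and fg: "f \<in> borel_measurable borel" "g \<in> borel_measurable borel"
    and "espans Z2 f g A"
  shows "espans Z1 f g A"
proof -
  have "(Top Z2 f g ^^ n) A \<subseteq> (Top Z1 f g ^^ n) A" for n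
  proof (induction n)
    case (Suc n)
    then show ?case
      using Top_mono_antimono[OF assms(1,2) Suc borel_Top_funpow[OF assms(3,4) fg]] by simp
  qed simp
  then have "(\<Union>n. (Top Z2 f g ^^ n) A) \<subseteq> (\<Union>n. (Top Z1 f g ^^ n) A)"
    by (intro UN_mono) auto
  moreover have "(\<Union>n. (Top Z1 f g ^^ n) A) \<subseteq> quadrant"
    by (intro UN_least Top_funpow_subset_quadrant assms(5))
  ultimately show ?thesis
    using assms(8) unfolding espans_def by simp
qed

lemma borel_measurable_admissible:
  assumes "admissible f"
  shows "f \<in> borel_measurable borel"
proof -
  \<comment> \<open>The sign turns a nonincreasing function into a monotone one;
    \<open>max 0\<close> is there because \<open>f\<close> vanishes on the negative axis and may
    jump up at 0.\<close>
  have "mono (\<lambda>x. - f (max 0 x))"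
    using assms by (auto simp: admissible_def mono_def)
  then have [measurable]: "(\<lambda>x. - f (max 0 x)) \<in> borel_measurable borel"
    by (rule borel_measurable_mono)
  have "f = (\<lambda>x. if x < 0 then 0 else - (- f (max 0 x)))"
    using assms by (auto simp: admissible_def fun_eq_iff)
  also have "\<dots> \<in> borel_measurable borel" by measurable
  finally show ?thesis .
qed

section \<open>Decreasing rearrangement\<close>

text \<open>Bridge from the gauge integral of the definitions to the Lebesgue integral, where
  Tonelli applies.\<close>

lemma integral_atLeast_0_eq_lborel:
  fixes f :: "real \<Rightarrow> real"
  assumes "integrable lborel f" "\<And>x. x < 0 \<Longrightarrow> f x = 0"
  shows "integral {0..} f = integral\<^sup>L lborel f"
proof -
  have "(\<lambda>x. if x \<in> {0..} then f x else 0) = f"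
    using assms(2) by (auto simp: fun_eq_iff)
  then show ?thesis
    using integral_restrict_UNIV[of "{0..}" f] integral_lborel[OF assms(1)] by simp
qed

lemma integrable_bounded_support:
  fixes f :: "real \<Rightarrow> real"
  assumes "f \<in> borel_measurable borel" "\<And>x. 0 \<le> f x" "\<And>x. f x \<le> B" "\<And>x. x < 0 \<or> M \<le> x \<Longrightarrow> f x = 0"
  shows "integrable lborel f"
proof (rule Bochner_Integration.integrable_bound)
  show "integrable lborel (\<lambda>x. B * indicator {0..max 0 M} x)"
    by simp
  show "AE x in lborel. norm (f x) \<le> norm (B * indicator {0..max 0 M} x)"
  proof (rule AE_I2)
    fix x
    show "norm (f x) \<le> norm (B * indicator {0..max 0 M} x)"
    proof (cases "x \<in> {0..max 0 M}")
      case True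
      then show ?thesis using assms(2)[of x] assms(3)[of x] by simp
    next
      case False
      then have "x < 0 \<or> M \<le> x" by auto
      then show ?thesis using assms(4)[of x] False by simp
    qed
  qed
qed (use assms(1) in simp)

section \<open>Bounds, integrals and sums of admissible functions\<close>

lemma admissible_bounded:
  assumes "admissible f"
  shows "0 \<le> f x" "f x \<le> f 0"
proof -
  show "0 \<le> f x" using assms unfolding admissible_def by (metis linorder_not_le order_refl)
  show "f x \<le> f 0" using assms unfolding admissible_def by (metis linorder_not_le order_refl)
qed

lemma integrable_admissible:
  assumes "admissible f"
  shows "integrable lborel f"
proof -
  obtain M where "\<And>x. M \<le> x \<Longrightarrow> f x = 0" using assms unfolding admissible_def by blast
  then show ?thesis
    using assms admissible_bounded[OF assms]
    by (intro integrable_bounded_support[of f "f 0" M] borel_measurable_admissible)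
       (auto simp: admissible_def)
qed

lemma integral_admissible:
  assumes "admissible f"
  shows "integral {0..} f = integral\<^sup>L lborel f"
  using integral_atLeast_0_eq_lborel[OF integrable_admissible[OF assms]] assms
  by (simp add: admissible_def)

lemma integral_admissible_nonneg:
  assumes "admissible f"
  shows "0 \<le> integral {0..} f"
  by (simp add: integral_admissible[OF assms] admissible_bounded[OF assms])

lemma admissible_step:
  assumes "0 \<le> c" "0 \<le> m"
  shows "admissible (\<lambda>x. c * indicator {0..m} x)"
proof -
  have "continuous (at_left x) (\<lambda>x. c * indicator {0..m} x)" if "0 < x" for x :: real
  proof -
    \<comment> \<open>The indicator is constant just to the left of \<open>x\<close>, even at
      \<open>x = m\<close>, because the interval is closed on the right.\<close>
    have "eventually (\<lambda>y. indicator {0..m} y = (indicator {0..m} x :: real)) (at_left x)"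
    proof (cases "x \<le> m")
      case True
      have "eventually (\<lambda>y. y \<in> {0<..<x}) (at_left x)"
        using that by (intro eventually_at_leftI[of 0]) auto
      then show ?thesis by eventually_elim (use True that in \<open>auto simp: indicator_def\<close>)
    next
      case False
      then have "eventually (\<lambda>y. y \<in> {m<..<x}) (at_left x)"
        by (intro eventually_at_leftI[of m]) auto
      then show ?thesis by eventually_elim (use False in \<open>auto simp: indicator_def\<close>)
    qed
    then have "eventually (\<lambda>y. c * indicator {0..m} y = c * (indicator {0..m} x :: real)) (at_left x)"
      by eventually_elim simp
    then show ?thesis
      unfolding continuous_within by (rule tendsto_eventually)
  qed
  moreover have "\<forall>x\<ge>m+1. c * indicator {0..m} x = 0" by simp
  ultimately show ?thesis
    using assms unfolding admissible_def
    by (auto simp: indicator_def intro!: exI[of _ "m+1"])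
qed

lemma admissible_zero: "admissible (\<lambda>x. 0)"
  by (auto simp: admissible_def)

lemma admissible_add:
  assumes "admissible f" "admissible g"
  shows "admissible (\<lambda>x. f x + g x)"
proof -
  obtain M where M: "\<And>x. M \<le> x \<Longrightarrow> f x = 0"
    using assms(1) unfolding admissible_def by blast
  obtain N where N: "\<And>x. N \<le> x \<Longrightarrow> g x = 0"
    using assms(2) unfolding admissible_def by blast
  have "\<exists>M. \<forall>x\<ge>M. f x + g x = 0" by (intro exI[of _ "max M N"]) (simp add: M N)
  then show ?thesis
    using assms unfolding admissible_def by (simp add: continuous_add add_mono)
qed

lemma admissible_sum:
  assumes "\<And>i. i \<in> I \<Longrightarrow> admissible (f i)"
  shows "admissible (\<lambda>x. \<Sum>i\<in>I. f i x)"
  using assms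
  by (induction I rule: infinite_finite_induct) (auto simp: admissible_zero intro: admissible_add)

text \<open>A discretised decreasing rearrangement: the superlevel sets of \<open>g\<close> at multiples of
  \<open>\<eta>\<close> are initial intervals as long as those of \<open>k\<close> one level lower.\<close>

lemma admissible_rearrangement:
  fixes k :: "real \<Rightarrow> real"
  assumes k [measurable]: "k \<in> borel_measurable borel"
    and nonneg: "\<And>x. 0 \<le> k x" and bdd: "\<And>x. k x \<le> B"
    and supp: "\<And>x. x < 0 \<or> M \<le> x \<Longrightarrow> k x = 0" and "0 < \<epsilon>"
  obtains g where "admissible g" "integral {0..} g \<le> integral {0..} k + \<epsilon>"
    "\<And>X. X \<subseteq> {0..} \<Longrightarrow> \<exists>J\<in>sets borel. emeasure lebesgue X \<le> emeasure lebesgue J \<and>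
        J \<subseteq> {x'. 0 \<le> x' \<and> (\<exists>x\<in>X. k x \<le> g x')}"
proof -
  \<comment> \<open>The support of \<open>k\<close> lies in \<open>{0..L}\<close>. Rounding up by
    one level \<open>\<eta>\<close> on an interval of length \<open>L\<close> costs exactly
    \<open>\<epsilon>\<close>.\<close>
  define L where "L = max 1 M"
  have L: "1 \<le> L" "M \<le> L" by (auto simp: L_def)
  define \<eta> where "\<eta> = \<epsilon> / L"
  have \<eta>: "0 < \<eta>" "\<eta> * L = \<epsilon>" using L \<open>0 < \<epsilon>\<close> by (auto simp: \<eta>_def)
  obtain N where N: "B < real N * \<eta>" using reals_Archimedean3[OF \<eta>(1)] by blast
  define E where "E j = {x \<in> {0..L}. real j * \<eta> \<le> k x}" for j
  have E_borel [measurable]: "E j \<in> sets borel" for j unfolding E_def by measurable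
  have E_sub: "E j \<subseteq> {0..L}" for j by (auto simp: E_def)
  have E_fin: "emeasure lborel (E j) < \<infinity>" for j
    proof -
    have "emeasure lborel (E j) \<le> emeasure lborel {0..L}"
      using E_sub by (intro emeasure_mono) auto
    also have "\<dots> = ennreal L" using L by simp
    finally show ?thesis using ennreal_less_top le_less_trans by (metis infinity_ennreal_def)
  qed
  define m where "m j = measure lborel (E j)" for j
  have m_eq: "emeasure lborel (E j) = ennreal (m j)" for j
    unfolding m_def using E_fin[of j] by (simp add: emeasure_eq_ennreal_measure less_top)
  have m_nonneg: "0 \<le> m j" for j by (simp add: m_def)
  have m_anti: "m j \<le> m i" if "i \<le> j" for i j
  proof -
    have "real i * \<eta> \<le> real j * \<eta>" using that \<eta>(1) by simp
    then have "E j \<subseteq> E i" unfolding E_def by force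
    then show ?thesis unfolding m_def using E_fin[of i]
      by (intro measure_mono_fmeasurable) (auto simp: fmeasurable_def)
  qed
  \<comment> \<open>The lengths \<open>m j\<close> decrease, so on \<open>{0..m j}\<close> the steps
    0 to \<open>j\<close> are all active and \<open>g\<close> is at least
    \<open>(j + 1) * \<eta>\<close> there if \<open>j < N\<close>.\<close>
  define g where "g x = (\<Sum>j<N. \<eta> * indicator {0..m j} x)" for x :: real
  have g_adm: "admissible g"
    unfolding g_def using \<eta>(1) m_nonneg by (intro admissible_sum admissible_step) auto
  have k_int: "integrable lborel k"
    by (rule integrable_bounded_support[OF k nonneg bdd supp])
  have ind_int: "integrable lborel (\<lambda>x. \<eta> * indicator (E j) x)" for j
    using E_fin[of j] by (auto intro!: integrable_mult_right)
  have L_int: "integrable lborel (\<lambda>x. \<eta> * indicator {0..L} x)"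
    using L by (intro integrable_mult_right) simp
  \<comment> \<open>At most \<open>n + 1\<close> of the sets \<open>E j\<close> contain
    \<open>x\<close>, where \<open>n\<close> is the integer part of \<open>k x / \<eta>\<close>. The
    extra one is level 0 and accounts for the error term.\<close>
  have levels: "(\<Sum>j<N. \<eta> * indicator (E j) x) \<le> \<eta> * indicator {0..L} x + k x" for x
  proof -
    define n where "n = nat \<lfloor>k x / \<eta>\<rfloor>"
    have le: "j \<le> n" if "x \<in> E j" for j
      using that \<eta>(1) nonneg[of x] unfolding n_def E_def
      by (simp add: le_nat_iff le_floor_iff field_simps)
    have "(\<Sum>j<N. \<eta> * indicator (E j) x) \<le> (\<Sum>j\<in>{..n}. \<eta> * indicator {0..L} x)"
    proof -
      have "(\<Sum>j<N. \<eta> * indicator (E j) x) = (\<Sum>j\<in>{..<N} \<inter> {..n}. \<eta> * indicator (E j) x)"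
        using le by (intro sum.mono_neutral_right) (auto simp: indicator_def)
      also have "\<dots> \<le> (\<Sum>j\<in>{..<N} \<inter> {..n}. \<eta> * indicator {0..L} x)"
        using \<eta>(1) E_sub by (intro sum_mono mult_left_mono) (auto simp: indicator_def E_def)
      also have "\<dots> \<le> (\<Sum>j\<in>{..n}. \<eta> * indicator {0..L} x)"
        using \<eta>(1) by (intro sum_mono2) auto
      finally show ?thesis .
    qed
    also have "\<dots> = \<eta> * indicator {0..L} x + real n * \<eta> * indicator {0..L} x"
      by (simp add: algebra_simps)
    also have "real n * \<eta> * indicator {0..L} x \<le> k x"
    proof -
      have "real n \<le> k x / \<eta>" unfolding n_def using nonneg[of x] \<eta>(1) by simp
      then have "real n * \<eta> \<le> k x" using \<eta>(1) by (simp add: field_simps)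
      then show ?thesis using nonneg[of x] by (auto simp: indicator_def)
    qed
    finally show ?thesis by simp
  qed
  \<comment> \<open>Replacing \<open>{0..m j}\<close> by \<open>E j\<close> keeps the integral,
    since both have length \<open>m j\<close>; the level sum is then compared with \<open>k\<close>
    pointwise.\<close>
  have "integral {0..} g = (\<Sum>j<N. \<eta> * m j)"
    unfolding integral_admissible[OF g_adm] unfolding g_def
    using m_nonneg by (subst Bochner_Integration.integral_sum) (auto intro!: integrable_mult_right)
  also have "\<dots> = (\<integral>x. (\<Sum>j<N. \<eta> * indicator (E j) x) \<partial>lborel)"
    using ind_int by (subst Bochner_Integration.integral_sum) (auto simp: m_def)
  also have "\<dots> \<le> (\<integral>x. \<eta> * indicator {0..L} x + k x \<partial>lborel)"
    by (intro integral_mono Bochner_Integration.integrable_sum Bochner_Integration.integrable_add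
        ind_int k_int L_int levels)
  also have "\<dots> = \<epsilon> + integral\<^sup>L lborel k"
    using L \<eta>(2) by (subst Bochner_Integration.integral_add[OF L_int k_int]) simp
  finally have g_le: "integral {0..} g \<le> integral {0..} k + \<epsilon>"
    using integral_atLeast_0_eq_lborel[OF k_int] supp by simp
  have "\<exists>J\<in>sets borel. emeasure lebesgue X \<le> emeasure lebesgue J \<and>
        J \<subseteq> {x'. 0 \<le> x' \<and> (\<exists>x\<in>X. k x \<le> g x')}" if X: "X \<subseteq> {0..}" for X
  \<comment> \<open>A zero of \<open>k\<close> in \<open>X\<close> makes the whole half-line
    available as \<open>J\<close>, because \<open>g \<ge> 0\<close>. This covers sets
    \<open>X\<close> that leave the support of \<open>k\<close>, including those of infinite
    measure.\<close>
  proof (cases "X = {} \<or> (\<exists>x\<in>X. k x = 0)")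
    case True
    then show ?thesis
    proof
      assume "X = {}"
      then show ?thesis by (intro bexI[of _ "{}"]) auto
    next
      assume "\<exists>x\<in>X. k x = 0"
      then obtain x where "x \<in> X" "k x = 0" by blast
      then have "{0..} \<subseteq> {x'. 0 \<le> x' \<and> (\<exists>x\<in>X. k x \<le> g x')}"
        using admissible_bounded(1)[OF g_adm] by (auto intro!: bexI[of _ x])
      moreover have "emeasure lebesgue X \<le> emeasure lebesgue {0::real..}"
        using X by (intro emeasure_mono) auto
      ultimately show ?thesis by (intro bexI[of _ "{0..}"]) auto
    qed
  next
    case False
    \<comment> \<open>The least such \<open>j\<close> is the level of the lowest values of
      \<open>k\<close> on \<open>X\<close>: \<open>k\<close> is at least \<open>j * \<eta>\<close>
      on all of \<open>X\<close> and below \<open>(j + 1) * \<eta>\<close> at some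
      \<open>x0\<close>. Hence \<open>X\<close> fits into \<open>E j\<close>, and \<open>x0\<close>
      serves for every point of \<open>{0..m j}\<close>.\<close>
    define P where "P j \<longleftrightarrow> (\<exists>x\<in>X. k x < real (Suc j) * \<eta>)" for j
    obtain x1 where "x1 \<in> X" using False by blast
    moreover obtain j1 where "k x1 < real j1 * \<eta>" using reals_Archimedean3[OF \<eta>(1)] by blast
    then have "k x1 < real (Suc j1) * \<eta>" using \<eta>(1) by (simp add: algebra_simps)
    ultimately have "P j1" by (auto simp: P_def)
    define j where "j = (LEAST j. P j)"
    have "P j" unfolding j_def using \<open>P j1\<close> by (rule LeastI)
    then obtain x0 where x0: "x0 \<in> X" "k x0 < real (Suc j) * \<eta>" by (auto simp: P_def)
    have low: "real j * \<eta> \<le> k x" if "x \<in> X" for x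
    proof (cases j)
      case 0
      then show ?thesis using nonneg by simp
    next
      case (Suc i)
      then have "\<not> P i" unfolding j_def by (metis lessI not_less_Least)
      then show ?thesis using that Suc by (auto simp: P_def not_less)
    qed
    have "X \<subseteq> E j"
    proof
      fix x assume "x \<in> X"
      then have "k x \<noteq> 0" "0 \<le> x" using False X by auto
      then have "x < M" using supp[of x] by linarith
      then show "x \<in> E j" using low[OF \<open>x \<in> X\<close>] L \<open>0 \<le> x\<close> by (simp add: E_def)
    qed
    then have "emeasure lebesgue X \<le> emeasure lebesgue (E j)"
      by (intro emeasure_mono) (auto simp: sets_completionI_sets)
    also have "\<dots> = emeasure lebesgue {0..m j}"
      using m_eq[of j] m_nonneg[of j] by simp
    finally have le: "emeasure lebesgue X \<le> emeasure lebesgue {0..m j}" .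
    have "real j * \<eta> < real N * \<eta>" using low[OF x0(1)] bdd[of x0] N by linarith
    then have "j < N" using \<eta>(1) by simp
    have "k x0 \<le> g x'" if "x' \<in> {0..m j}" for x'
    proof -
      have "real (Suc j) * \<eta> = (\<Sum>i\<in>{..j}. \<eta> * indicator {0..m i} x')"
      proof -
        have "indicator {0..m i} x' = (1::real)" if "i \<le> j" for i
          using m_anti[OF that] \<open>x' \<in> {0..m j}\<close> by (auto simp: indicator_def)
        then show ?thesis by simp
      qed
      also have "\<dots> \<le> g x'"
        unfolding g_def using \<open>j < N\<close> \<eta>(1) by (intro sum_mono2) auto
      finally show ?thesis using x0 by simp
    qed
    then show ?thesis using le x0(1) by (intro bexI[of _ "{0..m j}"]) (auto intro!: bexI[of _ x0])
  qed
  then show ?thesis using that[OF g_adm g_le] by blast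
qed

section \<open>From spanning sets to thin spanning pairs\<close>

text \<open>Points of the two runs are matched by the size of their enhancements, not by position.
  By the hypotheses on \<open>f\<close> and \<open>g\<close>, a set \<open>X\<close> of coordinates
  is outweighed by a set \<open>J\<close> whose members each dominate some member of
  \<open>X\<close>; inductively the row or column of the matched point contains
  \<open>J\<close>.\<close>

lemma Top_funpow_transfer:
  assumes Z: "lower_set Z" "closed Z"
    and meas: "f \<in> borel_measurable borel" "g \<in> borel_measurable borel"
    and f: "\<And>X. X \<subseteq> {0..} \<Longrightarrow> \<exists>J\<in>sets borel. emeasure lebesgue X \<le> emeasure lebesgue J \<and>
        J \<subseteq> {x'. 0 \<le> x' \<and> (\<exists>x\<in>X. h x \<le> f x')}"
    and g: "\<And>X. X \<subseteq> {0..} \<Longrightarrow> \<exists>J\<in>sets borel. emeasure lebesgue X \<le> emeasure lebesgue J \<and>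
        J \<subseteq> {x'. 0 \<le> x' \<and> (\<exists>x\<in>X. k x \<le> g x')}"
    and "(u, v) \<in> (Top Z h k ^^ n) {}" "0 \<le> u'" "0 \<le> v'" "k u \<le> g u'" "h v \<le> f v'"
  shows "(u', v') \<in> (Top Z f g ^^ n) {}"
  using assms(7-)
proof (induction n arbitrary: u v u' v')
  case (Suc n)
  let ?B = "(Top Z h k ^^ n) {}" and ?C = "(Top Z f g ^^ n) {}"
  have C: "?C \<in> sets borel" by (rule borel_Top_funpow[OF Z(2) _ meas]) simp
  have B: "?B \<subseteq> quadrant" by (rule Top_funpow_subset_quadrant) simp
  show ?case
  proof (cases "(u, v) \<in> ?B")
    case True
    then have "(u', v') \<in> ?C" using Suc by blast
    then show ?thesis by (simp add: mem_Top_iff)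
  next
    case False
    then have out: "notin_Z Z (row (u, v) ?B + ennreal (h v)) (col (u, v) ?B + ennreal (k u))"
      using Suc.prems(1) by (simp add: mem_Top_iff)
    \<comment> \<open>Along a row the heights \<open>v\<close> and \<open>v'\<close> stay fixed and
      the abscissa varies, so it is the hypothesis on \<open>k\<close> and \<open>g\<close> that
      applies here.\<close>
    have "row (u, v) ?B \<le> row (u', v') ?C"
    proof -
      have "{x. (x, v) \<in> ?B} \<subseteq> {0..}" using B by (auto simp: quadrant_def)
      from g[OF this] obtain J where J: "J \<in> sets borel"
        "emeasure lebesgue {x. (x, v) \<in> ?B} \<le> emeasure lebesgue J"
        "J \<subseteq> {x'. 0 \<le> x' \<and> (\<exists>x\<in>{x. (x, v) \<in> ?B}. k x \<le> g x')}" by blast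
      have "J \<subseteq> {x. (x, v') \<in> ?C}"
        using J(3) Suc.IH[OF _ _ Suc.prems(3) _ Suc.prems(5)] by blast
      then have "emeasure lebesgue J \<le> row (u', v') ?C"
        unfolding row_def
        by (intro emeasure_mono) (auto simp: sets_section_fst[OF C] sets_completionI_sets)
      then show ?thesis using J(2) by (simp add: row_def)
    qed
    moreover have "col (u, v) ?B \<le> col (u', v') ?C"
    proof -
      have "{y. (u, y) \<in> ?B} \<subseteq> {0..}" using B by (auto simp: quadrant_def)
      from f[OF this] obtain J where J: "J \<in> sets borel"
        "emeasure lebesgue {y. (u, y) \<in> ?B} \<le> emeasure lebesgue J"
        "J \<subseteq> {x'. 0 \<le> x' \<and> (\<exists>x\<in>{y. (u, y) \<in> ?B}. h x \<le> f x')}" by blast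
      have "J \<subseteq> {y. (u', y) \<in> ?C}"
        using J(3) Suc.IH[OF _ Suc.prems(2) _ Suc.prems(4)] by blast
      then have "emeasure lebesgue J \<le> col (u', v') ?C"
        unfolding col_def
        by (intro emeasure_mono) (auto simp: sets_section_snd[OF C] sets_completionI_sets)
      then show ?thesis using J(2) by (simp add: col_def)
    qed
    ultimately have "notin_Z Z (row (u', v') ?C + ennreal (f v')) (col (u', v') ?C + ennreal (g u'))"
      using Suc.prems(4,5) by (intro notin_Z_mono[OF Z(1) _ _ out] add_mono ennreal_leI) auto
    then show ?thesis using Suc.prems(2,3) by (simp add: mem_Top_iff)
  qed
qed simp

text \<open>A point without enhancement is the hardest to infect: every point of the quadrant
  dominates it, so by transfer the whole quadrant is infected at stage \<open>n\<close>.\<close>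

lemma espans_rearrangement:
  assumes Z: "lower_set Z" "closed Z" and "0 < \<epsilon>"
    and h: "h \<in> borel_measurable borel" "\<And>x. 0 \<le> h x" "\<And>x. h x \<le> B"
      "\<And>x. x < 0 \<or> M \<le> x \<Longrightarrow> h x = 0"
    and k: "k \<in> borel_measurable borel" "\<And>x. 0 \<le> k x" "\<And>x. k x \<le> B"
      "\<And>x. x < 0 \<or> M \<le> x \<Longrightarrow> k x = 0"
    and uv: "(u, v) \<in> (Top Z h k ^^ n) {}" "k u = 0" "h v = 0"
  obtains f g where "admissible f" "admissible g" "espans Z f g {}"
    "integral {0..} f + integral {0..} g \<le> integral {0..} h + integral {0..} k + \<epsilon>"
proof -
  have "0 < \<epsilon> / 2" using \<open>0 < \<epsilon>\<close> by simp
  obtain f where f: "admissible f" "integral {0..} f \<le> integral {0..} h + \<epsilon> / 2"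
    "\<And>X. X \<subseteq> {0..} \<Longrightarrow> \<exists>J\<in>sets borel. emeasure lebesgue X \<le> emeasure lebesgue J \<and>
        J \<subseteq> {x'. 0 \<le> x' \<and> (\<exists>x\<in>X. h x \<le> f x')}"
    using admissible_rearrangement[OF h \<open>0 < \<epsilon> / 2\<close>] by blast
  obtain g where g: "admissible g" "integral {0..} g \<le> integral {0..} k + \<epsilon> / 2"
    "\<And>X. X \<subseteq> {0..} \<Longrightarrow> \<exists>J\<in>sets borel. emeasure lebesgue X \<le> emeasure lebesgue J \<and>
        J \<subseteq> {x'. 0 \<le> x' \<and> (\<exists>x\<in>X. k x \<le> g x')}"
    using admissible_rearrangement[OF k \<open>0 < \<epsilon> / 2\<close>] by blast
  have "quadrant \<subseteq> (Top Z f g ^^ n) {}"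
  proof
    fix p assume "p \<in> quadrant"
    then have "(fst p, snd p) \<in> (Top Z f g ^^ n) {}"
      using uv admissible_bounded(1)[OF f(1)] admissible_bounded(1)[OF g(1)]
      by (intro Top_funpow_transfer[OF Z borel_measurable_admissible[OF f(1)]
            borel_measurable_admissible[OF g(1)] f(3) g(3) uv(1)]) (auto simp: quadrant_def)
    then show "p \<in> (Top Z f g ^^ n) {}" by simp
  qed
  moreover have "(\<Union>n. (Top Z f g ^^ n) {}) \<subseteq> quadrant"
    by (intro UN_least Top_funpow_subset_quadrant) simp
  ultimately have "espans Z f g {}"
    unfolding espans_def by (metis UNIV_I UN_upper order_trans subset_antisym)
  then show ?thesis using that[OF f(1) g(1)] f(2) g(2) by simp
qed

text \<open>Turns the row measures into a bounded real function of the height that can be added to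
  \<open>f\<close>; by Tonelli its integral is the area.\<close>

lemma row_profile:
  assumes A: "A \<in> sets borel" "A \<subseteq> rect N N" and "0 \<le> N"
  obtains r where "r \<in> borel_measurable borel" "\<And>v. 0 \<le> r v" "\<And>v. r v \<le> N"
    "\<And>v. v < 0 \<or> N < v \<Longrightarrow> r v = 0" "\<And>u v. row (u, v) A = ennreal (r v)"
    "integrable lborel r" "integral\<^sup>L lborel r = measure lborel A"
proof -
  define r where "r v = enn2real (row (0, v) A)" for v
  have le: "row p A \<le> ennreal N" for p
  proof -
    have "row p A \<le> emeasure lborel {0..N}"
      unfolding row_eq_lborel[OF A(1)] using A(2) by (intro emeasure_mono) (auto simp: rect_def)
    then show ?thesis using \<open>0 \<le> N\<close> by simp
  qed
  have eq: "row (u, v) A = ennreal (r v)" for u v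
    using le_less_trans[OF le ennreal_less_top, of "(0, v)"]
    unfolding r_def by (simp add: row_def less_top)
  have nonneg: "0 \<le> r v" for v by (simp add: r_def)
  have bdd: "r v \<le> N" for v using le[of "(0, v)"] \<open>0 \<le> N\<close> by (simp add: eq)
  have supp: "r v = 0" if "v < 0 \<or> N < v" for v
  proof -
    have "{x. (x, v) \<in> A} = {}" using A(2) that by (auto simp: rect_def)
    then show ?thesis by (simp add: r_def row_def)
  qed
  have meas: "r \<in> borel_measurable borel"
    unfolding r_def using measurable_row[OF A(1)] by measurable
  \<comment> \<open>The row at height exactly \<open>N\<close> may be nonempty, whereas
    \<open>integrable_bounded_support\<close> wants vanishing from its bound on; hence
    \<open>N + 1\<close>.\<close>
  have "integrable lborel r"
    by (rule integrable_bounded_support[OF meas nonneg bdd, of "N + 1"]) (auto intro: supp)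
  moreover have "integral\<^sup>L lborel r = measure lborel A"
    using nn_integral_row[OF A(1), of 0] nonneg meas unfolding eq measure_def
    by (subst integral_eq_nn_integral) auto
  ultimately show ?thesis using that[OF meas nonneg bdd supp eq] by blast
qed

lemma col_profile:
  assumes A: "A \<in> sets borel" "A \<subseteq> rect N N" and "0 \<le> N"
  obtains r where "r \<in> borel_measurable borel" "\<And>v. 0 \<le> r v" "\<And>v. r v \<le> N"
    "\<And>v. v < 0 \<or> N < v \<Longrightarrow> r v = 0" "\<And>u v. col (u, v) A = ennreal (r u)"
    "integrable lborel r" "integral\<^sup>L lborel r = measure lborel A"
proof -
  define r where "r v = enn2real (col (v, 0) A)" for v
  have le: "col p A \<le> ennreal N" for p
  proof -
    have "col p A \<le> emeasure lborel {0..N}"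
      unfolding col_eq_lborel[OF A(1)] using A(2) by (intro emeasure_mono) (auto simp: rect_def)
    then show ?thesis using \<open>0 \<le> N\<close> by simp
  qed
  have eq: "col (u, v) A = ennreal (r u)" for u v
    using le_less_trans[OF le ennreal_less_top, of "(u, 0)"]
    unfolding r_def by (simp add: col_def less_top)
  have nonneg: "0 \<le> r v" for v by (simp add: r_def)
  have bdd: "r v \<le> N" for v using le[of "(v, 0)"] \<open>0 \<le> N\<close> by (simp add: eq)
  have supp: "r v = 0" if "v < 0 \<or> N < v" for v
  proof -
    have "{y. (v, y) \<in> A} = {}" using A(2) that by (auto simp: rect_def)
    then show ?thesis by (simp add: r_def col_def)
  qed
  have meas: "r \<in> borel_measurable borel"
    unfolding r_def using measurable_col[OF A(1)] by measurable
  have "integrable lborel r"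
    by (rule integrable_bounded_support[OF meas nonneg bdd, of "N + 1"]) (auto intro: supp)
  moreover have "integral\<^sup>L lborel r = measure lborel A"
    using nn_integral_col[OF A(1), of 0] nonneg meas unfolding eq measure_def
    by (subst integral_eq_nn_integral) auto
  ultimately show ?thesis using that[OF meas nonneg bdd supp eq] by blast
qed

text \<open>Row and column measures of \<open>A\<close> added to \<open>f\<close> and \<open>g\<close> replace the set \<open>A\<close> itself: outside
  \<open>A\<close>, every point infected from \<open>A\<close> is then infected from the empty set. The points of \<open>A\<close> are
  recovered by transferring along a point at which both enhancements vanish.\<close>

lemma thin_from_compact:
  assumes Z: "lower_set Z" "closed Z" and "0 < \<epsilon>"
    and A: "compact A" "A \<subseteq> quadrant" and fg: "admissible f" "admissible g"
    and span: "espans Z f g A"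
  obtains f' g' where "admissible f'" "admissible g'" "espans Z f' g' {}"
    "integral {0..} f' + integral {0..} g' \<le>
      integral {0..} f + integral {0..} g + 2 * measure lborel A + \<epsilon>"
proof -
  have Ab: "A \<in> sets borel" using A(1) by (simp add: borel_compact)
  obtain M0 where M0: "\<And>x. x \<in> A \<Longrightarrow> norm x \<le> M0"
    using compact_imp_bounded[OF A(1)] unfolding bounded_iff by blast
  obtain M1 where M1: "\<And>x. M1 \<le> x \<Longrightarrow> f x = 0"
    using fg(1) unfolding admissible_def by blast
  obtain M2 where M2: "\<And>x. M2 \<le> x \<Longrightarrow> g x = 0"
    using fg(2) unfolding admissible_def by blast
  \<comment> \<open>From \<open>M\<close> on, \<open>f\<close>, \<open>g\<close> and the row and
    column measures of \<open>A\<close> all vanish. The entry \<open>M0 + 1\<close> puts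
    \<open>(M, M)\<close> outside \<open>A\<close>, and the entry 1 puts it in the quadrant.\<close>
  define M where "M = Max {1, M0 + 1, M1, M2}"
  have M: "1 \<le> M" "M0 + 1 \<le> M" "M1 \<le> M" "M2 \<le> M" by (auto simp: M_def)
  \<comment> \<open>The maximum matters for empty \<open>A\<close>, where \<open>M0\<close> may be
    negative.\<close>
  define N where "N = max 0 M0"
  have N: "0 \<le> N" "N < M" using M by (auto simp: N_def)
  have A_sub: "A \<subseteq> rect N N"
  proof (rule subrelI)
    fix a b assume ab: "(a, b) \<in> A"
    then have "\<bar>a\<bar> \<le> M0" "\<bar>b\<bar> \<le> M0"
      using M0[OF ab] norm_fst_le[of a b] norm_snd_le[of b a] by auto
    then show "(a, b) \<in> rect N N" using ab A(2) by (auto simp: quadrant_def rect_def N_def)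
  qed
  obtain r where r: "r \<in> borel_measurable borel" "\<And>v. 0 \<le> r v" "\<And>v. r v \<le> N"
    "\<And>v. v < 0 \<or> N < v \<Longrightarrow> r v = 0" "\<And>u v. row (u, v) A = ennreal (r v)"
    "integrable lborel r" "integral\<^sup>L lborel r = measure lborel A"
    using row_profile[OF Ab A_sub N(1)] by blast
  obtain c where c: "c \<in> borel_measurable borel" "\<And>v. 0 \<le> c v" "\<And>v. c v \<le> N"
    "\<And>v. v < 0 \<or> N < v \<Longrightarrow> c v = 0" "\<And>u v. col (u, v) A = ennreal (c u)"
    "integrable lborel c" "integral\<^sup>L lborel c = measure lborel A"
    using col_profile[OF Ab A_sub N(1)] by blast
  note [measurable] = r(1) c(1)
  define h where "h v = f v + r v" for v
  define k where "k u = g u + c u" for u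
  note f_props = borel_measurable_admissible[OF fg(1)] admissible_bounded[OF fg(1)]
  note g_props = borel_measurable_admissible[OF fg(2)] admissible_bounded[OF fg(2)]
  have f_supp: "f x = 0" if "x < 0 \<or> M \<le> x" for x
    using that M1[of x] M fg(1) unfolding admissible_def by fastforce
  have g_supp: "g x = 0" if "x < 0 \<or> M \<le> x" for x
    using that M2[of x] M fg(2) unfolding admissible_def by fastforce
  define B where "B = f 0 + g 0 + N"
  have h: "h \<in> borel_measurable borel" "\<And>x. 0 \<le> h x" "\<And>x. h x \<le> B"
      "\<And>x. x < 0 \<or> M \<le> x \<Longrightarrow> h x = 0"
  proof -
    show "h \<in> borel_measurable borel" unfolding h_def using f_props(1) by measurable
    show "0 \<le> h x" for x using f_props(2)[of x] r(2)[of x] by (simp add: h_def)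
    show "h x \<le> B" for x
      using f_props(3)[of x] r(3)[of x] g_props(2)[of 0] by (simp add: h_def B_def)
    show "h x = 0" if "x < 0 \<or> M \<le> x" for x
      using f_supp[OF that] r(4)[of x] that N by (auto simp: h_def)
  qed
  have k: "k \<in> borel_measurable borel" "\<And>x. 0 \<le> k x" "\<And>x. k x \<le> B"
      "\<And>x. x < 0 \<or> M \<le> x \<Longrightarrow> k x = 0"
  proof -
    show "k \<in> borel_measurable borel" unfolding k_def using g_props(1) by measurable
    show "0 \<le> k x" for x using g_props(2)[of x] c(2)[of x] by (simp add: k_def)
    show "k x \<le> B" for x
      using g_props(3)[of x] c(3)[of x] f_props(2)[of 0] by (simp add: k_def B_def)
    show "k x = 0" if "x < 0 \<or> M \<le> x" for x
      using g_supp[OF that] c(4)[of x] that N by (auto simp: k_def)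
  qed
  have h_int: "integral {0..} h = integral {0..} f + measure lborel A"
  proof -
    have "integral {0..} h = integral\<^sup>L lborel h"
      by (intro integral_atLeast_0_eq_lborel integrable_bounded_support[OF h] h(4)) auto
    also have "\<dots> = integral\<^sup>L lborel f + integral\<^sup>L lborel r"
      unfolding h_def by (rule Bochner_Integration.integral_add[OF integrable_admissible[OF fg(1)] r(6)])
    finally show ?thesis by (simp add: integral_admissible[OF fg(1)] r(7))
  qed
  have k_int: "integral {0..} k = integral {0..} g + measure lborel A"
  proof -
    have "integral {0..} k = integral\<^sup>L lborel k"
      by (intro integral_atLeast_0_eq_lborel integrable_bounded_support[OF k] k(4)) auto
    also have "\<dots> = integral\<^sup>L lborel g + integral\<^sup>L lborel c"
      unfolding k_def by (rule Bochner_Integration.integral_add[OF integrable_admissible[OF fg(2)] c(6)])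
    finally show ?thesis by (simp add: integral_admissible[OF fg(2)] c(7))
  qed
  have dom: "(Top Z f g ^^ n) A - A \<subseteq> (Top Z h k ^^ n) {}" for n
  proof (induction n)
    case (Suc n)
    let ?A = "(Top Z f g ^^ n) A" and ?B = "(Top Z h k ^^ n) {}"
    have B: "?B \<in> sets borel" by (rule borel_Top_funpow[OF Z(2) _ h(1) k(1)]) simp
    have sub: "?A \<subseteq> ?B \<union> A" using Suc by blast
    have BA: "?B \<union> A \<in> sets borel" using B Ab by blast
    \<comment> \<open>The part of the row outside \<open>A\<close> lies in \<open>?B\<close> by
      induction; the part inside has length \<open>r v\<close>, which is the surplus of
      \<open>h v\<close> over \<open>f v\<close>.\<close>
    have row_le: "row (u, v) ?A \<le> row (u, v) ?B + ennreal (r v)" for u v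
    proof -
      have "row (u, v) ?A \<le> row (u, v) (?B \<union> A)" by (rule row_mono[OF sub BA])
      also have "\<dots> \<le> row (u, v) ?B + row (u, v) A"
        unfolding row_eq_lborel[OF BA] row_eq_lborel[OF B] row_eq_lborel[OF Ab] Un_iff Collect_disj_eq
        by (intro emeasure_subadditive) (auto simp: sets_section_fst B Ab)
      finally show ?thesis by (simp add: r(5))
    qed
    have col_le: "col (u, v) ?A \<le> col (u, v) ?B + ennreal (c u)" for u v
    proof -
      have "col (u, v) ?A \<le> col (u, v) (?B \<union> A)" by (rule col_mono[OF sub BA])
      also have "\<dots> \<le> col (u, v) ?B + col (u, v) A"
        unfolding col_eq_lborel[OF BA] col_eq_lborel[OF B] col_eq_lborel[OF Ab] Un_iff Collect_disj_eq
        by (intro emeasure_subadditive) (auto simp: sets_section_snd B Ab)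
      finally show ?thesis by (simp add: c(5))
    qed
    have "notin_Z Z (row (u, v) ?B + ennreal (h v)) (col (u, v) ?B + ennreal (k u))"
      if "notin_Z Z (row (u, v) ?A + ennreal (f v)) (col (u, v) ?A + ennreal (g u))" for u v
    proof (rule notin_Z_mono[OF Z(1) _ _ that])
      show "row (u, v) ?A + ennreal (f v) \<le> row (u, v) ?B + ennreal (h v)"
        using add_right_mono[OF row_le[of u v], where c = "ennreal (f v)"] f_props(2)[of v] r(2)[of v]
        by (simp add: h_def ennreal_plus ac_simps)
      show "col (u, v) ?A + ennreal (g u) \<le> col (u, v) ?B + ennreal (k u)"
        using add_right_mono[OF col_le[of u v], where c = "ennreal (g u)"] g_props(2)[of u] c(2)[of u]
        by (simp add: k_def ennreal_plus ac_simps)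
    qed
    then show ?case
      using Suc by (intro subrelI) (auto simp: mem_Top_iff)
  qed simp
  \<comment> \<open>This point is outside \<open>A\<close> and both enhancements vanish there, so
    its infection is what \<open>espans_rearrangement\<close> asks for.\<close>
  have "(M, M) \<in> (\<Union>n. (Top Z f g ^^ n) A)"
    using span M(1) unfolding espans_def by (simp add: quadrant_def)
  then obtain n where "(M, M) \<in> (Top Z f g ^^ n) A" by blast
  moreover have "(M, M) \<notin> A" using A_sub N by (auto simp: rect_def)
  ultimately have "(M, M) \<in> (Top Z h k ^^ n) {}" using dom by blast
  from espans_rearrangement[OF Z \<open>0 < \<epsilon>\<close> h k this k(4) h(4)] that show ?thesis
    unfolding h_int k_int by (simp add: algebra_simps) blast
qed

section \<open>Bounds and limits\<close>

text \<open>Only horizontal growth is used: the rows are filled from the bottom up, the enhancement of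
  row \<open>v\<close> exceeding the width of \<open>Z\<close> at the height \<open>v - \<delta>\<close> already reached.\<close>

lemma thin_le_area:
  assumes Z: "lower_set Z" "closed Z" and sub: "Z \<subseteq> rect R R" and R: "0 \<le> R"
  obtains f g where "admissible f" "admissible g" "espans Z f g {}"
    "integral {0..} f + integral {0..} g \<le> measure lborel Z + 1"
proof -
  have Zb: "Z \<in> sets borel" using Z(2) by (simp add: borel_closed)
  obtain r where r: "r \<in> borel_measurable borel" "\<And>v. 0 \<le> r v" "\<And>v. r v \<le> R"
    "\<And>v. v < 0 \<or> R < v \<Longrightarrow> r v = 0" "\<And>u v. row (u, v) Z = ennreal (r v)"
    "integrable lborel r" "integral\<^sup>L lborel r = measure lborel Z"
    using row_profile[OF Zb sub R] by blast
  note [measurable] = r(1)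
  \<comment> \<open>Chosen so that the overhead of \<open>h\<close> over the area is at most 1/2;
    the other 1/2 of the bound is left for the rearrangement.\<close>
  define \<delta> where "\<delta> = 1 / (2 * (2 * R + 1))"
  have \<delta>: "0 < \<delta>" "\<delta> * R + \<delta> * (R + 1) = 1 / 2"
  proof -
    show "0 < \<delta>" using R by (simp add: \<delta>_def)
    have "\<delta> * (2 * (2 * R + 1)) = 1" using R by (simp add: \<delta>_def)
    then show "\<delta> * R + \<delta> * (R + 1) = 1 / 2" by (simp add: algebra_simps)
  qed
  \<comment> \<open>A row of a lower set contains the full interval from 0 to each of its points, so
    a point of \<open>Z\<close> at abscissa \<open>r t + \<delta>\<close> would make the row longer
    than \<open>r t\<close>.\<close>
  have out: "(r t + \<delta>, t) \<notin> Z" for t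
  proof
    assume "(r t + \<delta>, t) \<in> Z"
    then have "rect (r t + \<delta>) t \<subseteq> Z" "0 \<le> t"
      using Z(1) by (auto simp: lower_set_def quadrant_def)
    then have "{0..r t + \<delta>} \<subseteq> {x. (x, t) \<in> Z}" by (auto simp: rect_def)
    then have "emeasure lborel {0..r t + \<delta>} \<le> row (0, t) Z"
      unfolding row_eq_lborel[OF Zb] by (intro emeasure_mono) (auto simp: sets_section_fst[OF Zb])
    then show False using r(2)[of t] \<delta>(1) by (simp add: r(5))
  qed
  \<comment> \<open>The support reaches beyond \<open>R\<close>, because a column longer than
    \<open>R\<close> leaves \<open>Z\<close> unaided. Rearrangement later replaces \<open>h\<close>
    by an admissible function.\<close>
  define h where "h v = (if 0 \<le> v \<and> v \<le> R + 1 then r (max 0 (v - \<delta>)) + \<delta> else 0)" for v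
  define k where "k u = (0::real)" for u :: real
  let ?B = "\<lambda>n. (Top Z h k ^^ n) {}"
  have h: "h \<in> borel_measurable borel" "\<And>x. 0 \<le> h x" "\<And>x. h x \<le> R + \<delta>"
      "\<And>x. x < 0 \<or> R + 2 \<le> x \<Longrightarrow> h x = 0"
    using r(2,3) \<delta>(1) R unfolding h_def by (auto intro: add_nonneg_nonneg)
  have k: "k \<in> borel_measurable borel" "\<And>x. 0 \<le> k x" "\<And>x. k x \<le> R + \<delta>"
      "\<And>x. x < 0 \<or> R + 2 \<le> x \<Longrightarrow> k x = 0"
    using \<delta>(1) R by (auto simp: k_def[abs_def])
  have col_ge: "ennreal t \<le> col (u, v) (?B n)"
    if "0 \<le> u" "0 \<le> t" "\<And>u w. 0 \<le> u \<Longrightarrow> 0 \<le> w \<Longrightarrow> w \<le> t \<Longrightarrow> (u, w) \<in> ?B n" for t u v n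
  proof -
    have B: "?B n \<in> sets borel" by (rule borel_Top_funpow[OF Z(2) _ h(1) k(1)]) simp
    have "emeasure lborel {0..t} \<le> col (u, v) (?B n)"
      unfolding col_eq_lborel[OF B] using that
      by (intro emeasure_mono) (auto simp: sets_section_snd[OF B])
    then show ?thesis using that(2) by simp
  qed
  \<comment> \<open>Stage \<open>n\<close> fills the strip up to height \<open>n * \<delta>\<close>,
    capped at \<open>R + 1\<close>. Stage 0 is empty, hence \<open>0 < n\<close>; the first stage
    relies on no column, since then \<open>t = 0\<close>.\<close>
  have grow: "(u, v) \<in> ?B n" if "0 \<le> u" "0 \<le> v" "v \<le> R + 1" "v \<le> real n * \<delta>" "0 < n" for u v n
    using that
  proof (induction n arbitrary: u v)
    case (Suc n)
    define t where "t = max 0 (v - \<delta>)"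
    have t: "0 \<le> t" "t \<le> R + 1" "t \<le> real n * \<delta>" "h v = r t + \<delta>"
      using Suc.prems \<delta>(1) R by (auto simp: t_def h_def algebra_simps)
    have "ennreal t \<le> col (u, v) (?B n)"
    proof (cases "n = 0")
      case True
      then have "t = 0" using t by simp
      then show ?thesis by simp
    next
      case False
      then show ?thesis using t Suc.IH Suc.prems(1) by (intro col_ge) auto
    qed
    moreover have "notin_Z Z (ennreal (r t + \<delta>)) (ennreal t)"
      using out[of t] t(1) r(2)[of t] \<delta>(1) by (simp add: notin_Z_def del: ennreal_plus)
    ultimately have "notin_Z Z (row (u, v) (?B n) + ennreal (h v)) (col (u, v) (?B n) + ennreal (k u))"
      unfolding t(4) k_def by (elim notin_Z_mono[OF Z(1), rotated 2]) auto
    then show ?case using Suc.prems by (simp add: mem_Top_iff)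
  qed simp
  obtain n where n: "R + 1 < real n * \<delta>" using reals_Archimedean3[OF \<delta>(1)] by blast
  have "0 < n" using n R by (cases n) auto
  \<comment> \<open>Once the strip is full, its columns alone leave \<open>Z\<close>. This infects
    \<open>(0, R + 2)\<close>, where both \<open>h\<close> and \<open>k\<close> vanish.\<close>
  have "ennreal (R + 1) \<le> col (0, R + 2) (?B n)"
    using grow[OF _ _ _ _ \<open>0 < n\<close>] n R by (intro col_ge) auto
  moreover have "notin_Z Z 0 (ennreal (R + 1))"
    using sub R by (auto simp: notin_Z_def rect_def simp del: ennreal_plus)
  ultimately have "notin_Z Z (row (0, R + 2) (?B n) + ennreal (h (R + 2)))
      (col (0, R + 2) (?B n) + ennreal (k 0))"
    unfolding k_def by (elim notin_Z_mono[OF Z(1), rotated 2]) auto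
  then have "(0, R + 2) \<in> ?B (Suc n)" using R by (simp add: mem_Top_iff)
  from espans_rearrangement[OF Z _ h k this k_def h(4), of "1/2"]
  obtain f g where fg: "admissible f" "admissible g" "espans Z f g {}"
    "integral {0..} f + integral {0..} g \<le> integral {0..} h + integral {0..} k + 1 / 2"
    by auto
  have shift: "integrable lborel (\<lambda>v. r (v - \<delta>))" "(\<integral>v. r (v - \<delta>) \<partial>lborel) = measure lborel Z"
    using lborel_integrable_real_affine[OF r(6), of 1 "- \<delta>"]
      lborel_integral_real_affine[of 1 r "- \<delta>"] r(7) by auto
  have ints: "integrable lborel (\<lambda>v. R * indicator {0..\<delta>} v)"
    "integrable lborel (\<lambda>v. \<delta> * indicator {0..R+1} v)"
    using \<delta>(1) R by (auto intro!: integrable_mult_right)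
  \<comment> \<open>On \<open>{0..\<delta>}\<close> the width \<open>r 0\<close> is bounded crudely
    by \<open>R\<close>; above it \<open>h\<close> is a shift of \<open>r\<close>, whose integral is
    the area, plus \<open>\<delta>\<close>.\<close>
  have "integral\<^sup>L lborel h \<le> (\<integral>v. (R * indicator {0..\<delta>} v + \<delta> * indicator {0..R+1} v) + r (v - \<delta>) \<partial>lborel)"
  proof (rule integral_mono)
    show "integrable lborel h" by (rule integrable_bounded_support[OF h])
    show "integrable lborel (\<lambda>v. (R * indicator {0..\<delta>} v + \<delta> * indicator {0..R+1} v) + r (v - \<delta>))"
      by (intro Bochner_Integration.integrable_add ints shift)
    fix v
    have "r 0 \<le> R" "0 \<le> r (v - \<delta>)" using r(2,3) by auto
    then show "h v \<le> (R * indicator {0..\<delta>} v + \<delta> * indicator {0..R+1} v) + r (v - \<delta>)"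
      using R \<delta>(1) by (auto simp: h_def indicator_def max_def)
  qed
  also have "\<dots> = \<delta> * R + \<delta> * (R + 1) + measure lborel Z"
    using \<delta>(1) R shift ints
    by (subst Bochner_Integration.integral_add)
       (auto simp: Bochner_Integration.integral_add[OF ints] algebra_simps
        intro!: Bochner_Integration.integrable_add)
  finally have "integral {0..} h \<le> measure lborel Z + 1 / 2"
    unfolding \<delta>(2) using integral_atLeast_0_eq_lborel[OF integrable_bounded_support[OF h]] h(4) by simp
  moreover have "integral {0..} k = 0" by (simp add: k_def[abs_def])
  ultimately show ?thesis using that[OF fg(1-3)] fg(4) by simp
qed

section \<open>The infima for bounded zero-sets\<close>

lemma gamma_thin_bdd_props:
  assumes Z: "lower_set Z" "closed Z" and sub: "Z \<subseteq> rect R R" and R: "0 \<le> R"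
  shows "\<And>f g. admissible f \<Longrightarrow> admissible g \<Longrightarrow> espans Z f g {} \<Longrightarrow>
      gamma_thin_bdd Z \<le> integral {0..} f + integral {0..} g"
    and "gamma_thin_bdd Z \<le> measure lborel Z + 1"
    and "0 \<le> gamma_thin_bdd Z"
    and "\<And>x. (\<And>f g. admissible f \<Longrightarrow> admissible g \<Longrightarrow> espans Z f g {} \<Longrightarrow>
      x \<le> integral {0..} f + integral {0..} g) \<Longrightarrow> x \<le> gamma_thin_bdd Z"
proof -
  let ?S = "{integral {0..} f + integral {0..} g
      | f g. admissible f \<and> admissible g \<and> espans Z f g {}}"
  have bdd: "bdd_below ?S"
    by (rule bdd_belowI[of _ 0]) (auto intro!: add_nonneg_nonneg integral_admissible_nonneg)
  \<comment> \<open>A competitor must exist for the real \<open>Inf\<close> to be a genuine infimum;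
    nonnegativity gives the bound from below.\<close>
  obtain f0 g0 where fg0: "admissible f0" "admissible g0" "espans Z f0 g0 {}"
    "integral {0..} f0 + integral {0..} g0 \<le> measure lborel Z + 1"
    using thin_le_area[OF Z sub R] by blast
  show le: "gamma_thin_bdd Z \<le> integral {0..} f + integral {0..} g"
    if "admissible f" "admissible g" "espans Z f g {}" for f g
    unfolding gamma_thin_bdd_def by (rule cInf_lower[OF _ bdd]) (use that in blast)
  show "gamma_thin_bdd Z \<le> measure lborel Z + 1"
    using le[OF fg0(1-3)] fg0(4) by linarith
  show ge: "x \<le> gamma_thin_bdd Z"
    if "\<And>f g. admissible f \<Longrightarrow> admissible g \<Longrightarrow> espans Z f g {} \<Longrightarrow>
      x \<le> integral {0..} f + integral {0..} g" for x
    unfolding gamma_thin_bdd_def by (rule cInf_greatest) (use fg0 that in auto)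
  show "0 \<le> gamma_thin_bdd Z"
    by (intro ge add_nonneg_nonneg integral_admissible_nonneg)
qed

lemma I_bdd_lower:
  assumes "\<alpha> \<le> 1" "\<beta> \<le> 1" "compact A" "A \<subseteq> quadrant" "admissible f" "admissible g" "espans Z f g A"
  shows "I_bdd \<alpha> \<beta> Z \<le> measure lborel A + (1 - \<alpha>) * integral {0..} f + (1 - \<beta>) * integral {0..} g"
  unfolding I_bdd_def
proof (rule cInf_lower)
  show "bdd_below {measure lborel A + (1 - \<alpha>) * integral {0..} f + (1 - \<beta>) * integral {0..} g
      | A f g. compact A \<and> A \<subseteq> quadrant \<and> admissible f \<and> admissible g \<and> espans Z f g A}"
    using assms(1,2)
    by (intro bdd_belowI[of _ 0])
       (auto intro!: add_nonneg_nonneg mult_nonneg_nonneg integral_admissible_nonneg)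
qed (use assms in blast)

lemma I_bdd_greatest:
  assumes Z: "lower_set Z" "closed Z" "Z \<subseteq> rect R R" "0 \<le> R"
    and "\<And>A f g. compact A \<Longrightarrow> A \<subseteq> quadrant \<Longrightarrow> admissible f \<Longrightarrow> admissible g \<Longrightarrow> espans Z f g A \<Longrightarrow>
      x \<le> measure lborel A + (1 - \<alpha>) * integral {0..} f + (1 - \<beta>) * integral {0..} g"
  shows "x \<le> I_bdd \<alpha> \<beta> Z"
proof -
  obtain f g where "admissible f" "admissible g" "espans Z f g {}"
    using thin_le_area[OF Z] by blast
  then have "\<exists>A f g. compact A \<and> A \<subseteq> quadrant \<and> admissible f \<and> admissible g \<and> espans Z f g A"
    by (intro exI[of _ "{}"]) auto
  then show ?thesis
    unfolding I_bdd_def by (intro cInf_greatest) (use assms(5) in auto)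
qed

text \<open>Thin pairs compete with \<open>A = {}\<close>, which gives the upper bound. Scaling
  holds because area has weight 1, at least \<open>1 - \<alpha>\<close>. For the last bound, trading
  \<open>A\<close> for a thin pair costs twice its area at weight \<open>1 - \<alpha>\<close>, which
  its own weight 1 pays for when \<open>\<alpha> \<ge> 1/2\<close>.\<close>

lemma I_bdd_bounds:
  assumes Z: "lower_set Z" "closed Z" "Z \<subseteq> rect R R" "0 \<le> R" and \<alpha>: "0 \<le> \<alpha>" "\<alpha> \<le> 1"
  shows "0 \<le> I_bdd \<alpha> \<alpha> Z"
    and "I_bdd \<alpha> \<alpha> Z \<le> gamma_thin_bdd Z * (1 - \<alpha>)"
    and "(1 - \<alpha>) * I_bdd 0 0 Z \<le> I_bdd \<alpha> \<alpha> Z"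
    and "1 / 2 \<le> \<alpha> \<Longrightarrow> gamma_thin_bdd Z * (1 - \<alpha>) \<le> I_bdd \<alpha> \<alpha> Z"
proof -
  note thin = gamma_thin_bdd_props[OF Z]
  show nn: "0 \<le> I_bdd \<alpha> \<alpha> Z"
    using \<alpha> by (intro I_bdd_greatest[OF Z])
      (auto intro!: add_nonneg_nonneg mult_nonneg_nonneg integral_admissible_nonneg)
  show "I_bdd \<alpha> \<alpha> Z \<le> gamma_thin_bdd Z * (1 - \<alpha>)"
  \<comment> \<open>The general case divides by \<open>1 - \<alpha>\<close>. At
    \<open>\<alpha> = 1\<close> any thin pair costs nothing.\<close>
  proof (cases "\<alpha> = 1")
    case True
    obtain f g where fg: "admissible f" "admissible g" "espans Z f g {}"
      using thin_le_area[OF Z] by blast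
    show ?thesis using I_bdd_lower[OF \<alpha>(2,2) compact_empty _ fg] True by simp
  next
    case False
    then have s: "0 < 1 - \<alpha>" using \<alpha> by simp
    have "I_bdd \<alpha> \<alpha> Z / (1 - \<alpha>) \<le> gamma_thin_bdd Z"
    proof (rule thin(4))
      fix f g assume fg: "admissible f" "admissible g" "espans Z f g {}"
      have "I_bdd \<alpha> \<alpha> Z \<le> (1 - \<alpha>) * (integral {0..} f + integral {0..} g)"
        using I_bdd_lower[OF \<alpha>(2,2) compact_empty _ fg] by (simp add: algebra_simps)
      then show "I_bdd \<alpha> \<alpha> Z / (1 - \<alpha>) \<le> integral {0..} f + integral {0..} g"
        using s by (simp add: pos_divide_le_eq mult.commute)
    qed
    then show ?thesis using s by (simp add: pos_divide_le_eq)
  qed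
  show "(1 - \<alpha>) * I_bdd 0 0 Z \<le> I_bdd \<alpha> \<alpha> Z"
  proof (rule I_bdd_greatest[OF Z])
    fix A f g assume Afg: "compact A" "A \<subseteq> quadrant" "admissible f" "admissible g" "espans Z f g A"
    have "I_bdd 0 0 Z \<le> measure lborel A + integral {0..} f + integral {0..} g"
      using I_bdd_lower[OF _ _ Afg, of 0 0] by simp
    then have "(1 - \<alpha>) * I_bdd 0 0 Z \<le> (1 - \<alpha>) * (measure lborel A + integral {0..} f + integral {0..} g)"
      using \<alpha> by (intro mult_left_mono) auto
    moreover have "(1 - \<alpha>) * measure lborel A \<le> measure lborel A"
      using \<alpha> by (simp add: mult_left_le_one_le)
    ultimately show "(1 - \<alpha>) * I_bdd 0 0 Z \<le>
        measure lborel A + (1 - \<alpha>) * integral {0..} f + (1 - \<alpha>) * integral {0..} g"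
      by (simp add: distrib_left)
  qed
  show "gamma_thin_bdd Z * (1 - \<alpha>) \<le> I_bdd \<alpha> \<alpha> Z" if "1 / 2 \<le> \<alpha>"
  proof (rule I_bdd_greatest[OF Z])
    fix A f g assume Afg: "compact A" "A \<subseteq> quadrant" "admissible f" "admissible g" "espans Z f g A"
    let ?T = "integral {0..} f + integral {0..} g"
    have "gamma_thin_bdd Z \<le> ?T + 2 * measure lborel A"
    proof (rule field_le_epsilon)
      fix e :: real assume "0 < e"
      obtain f' g' where fg': "admissible f'" "admissible g'" "espans Z f' g' {}"
        "integral {0..} f' + integral {0..} g' \<le> ?T + 2 * measure lborel A + e"
        using thin_from_compact[OF Z(1,2) \<open>0 < e\<close> Afg] by blast
      show "gamma_thin_bdd Z \<le> ?T + 2 * measure lborel A + e"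
        using thin(1)[OF fg'(1-3)] fg'(4) by (rule order_trans)
    qed
    then have "(1 - \<alpha>) * gamma_thin_bdd Z \<le> (1 - \<alpha>) * (?T + 2 * measure lborel A)"
      using \<alpha> by (intro mult_left_mono) auto
    moreover have "(2 * (1 - \<alpha>)) * measure lborel A \<le> measure lborel A"
      using \<alpha> that by (intro mult_left_le_one_le) auto
    ultimately show "gamma_thin_bdd Z * (1 - \<alpha>) \<le>
        measure lborel A + (1 - \<alpha>) * integral {0..} f + (1 - \<alpha>) * integral {0..} g"
      by (simp add: algebra_simps)
  qed
qed

section \<open>Limits over the truncations\<close>

lemma tendsto_Lim_mono_bounded:
  fixes F :: "real \<Rightarrow> real"
  assumes "mono F" "\<And>x. F x \<le> C"
  shows "(F \<longlongrightarrow> Lim at_top F) at_top"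
proof -
  have bdd: "bdd_above (range F)" using assms(2) by (intro bdd_aboveI[of _ C]) auto
  have "(F \<longlongrightarrow> (SUP x. F x)) at_top"
  proof (rule increasing_tendsto)
    show "\<forall>\<^sub>F x in at_top. F x \<le> (SUP x. F x)"
      using cSUP_upper[OF UNIV_I bdd] by auto
    fix y assume "y < (SUP x. F x)"
    then obtain x0 where "y < F x0" using less_cSUP_iff[OF _ bdd] by auto
    then show "\<forall>\<^sub>F x in at_top. y < F x"
      using assms(1) unfolding mono_def eventually_at_top_linorder by (meson less_le_trans)
  qed
  \<comment> \<open>\<open>Lim\<close> is a definite description, so it denotes the limit only once
    convergence, here to the supremum, is known.\<close>
  then show ?thesis using tendsto_Lim[OF trivial_limit_at_top_linorder] by metis
qed

theorem mainTheorem19: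
  fixes Z :: "(real \<times> real) set"
  assumes "euclid_zero_set Z" and "emeasure lborel Z < \<infinity>"
  shows "(\<forall>\<alpha>::real. 0 \<le> \<alpha> \<and> \<alpha> \<le> 1 \<longrightarrow>
            gamma_thin_E Z * ((1 - \<alpha>) - 2 * (1 - \<alpha>)^2) \<le> I_E \<alpha> \<alpha> Z
          \<and> I_E \<alpha> \<alpha> Z \<le> gamma_thin_E Z * (1 - \<alpha>))
       \<and> ((\<forall>\<alpha>::real. 0 \<le> \<alpha> \<and> \<alpha> \<le> 1 \<longrightarrow> I_E \<alpha> \<alpha> Z = (1 - \<alpha>) * gamma_E Z)
            \<longleftrightarrow> gamma_thin_E Z = gamma_E Z)"
proof -
  let ?Z = "\<lambda>R. Z \<inter> rect R R"
  have Zcl: "closed Z" using assms(1) by (simp add: euclid_zero_set_def)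
  have lower: "lower_set (?Z R)" for R
    using assms(1) unfolding lower_set_def euclid_zero_set_def by (auto simp: rect_def)
  have cl: "closed (?Z R)" for R
    using Zcl unfolding rect_def by (intro closed_Int closed_Times) auto
  \<comment> \<open>\<open>R\<close> ranges over all reals, while the lemmas for bounded zero-sets
    ask for a nonnegative side length.\<close>
  have sub: "?Z R \<subseteq> rect (max 0 R) (max 0 R)" for R by (auto simp: rect_def)
  note trunc = lower cl sub max.cobounded1
  note thin = gamma_thin_bdd_props[OF trunc] and I = I_bdd_bounds[OF trunc]
  have mono_Z: "?Z R \<subseteq> ?Z S" if "R \<le> S" for R S using that by (auto simp: rect_def)
  have anti: "espans (?Z R) f g A"
    if "R \<le> S" "compact A" "A \<subseteq> quadrant" "admissible f" "admissible g" "espans (?Z S) f g A"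
    for R S A f g
    using that
    by (intro espans_antimono[OF lower mono_Z cl _ _ _ _ that(6)])
       (auto simp: borel_compact borel_measurable_admissible)
  have mono_thin: "mono (\<lambda>R. gamma_thin_bdd (?Z R))"
  proof (rule monoI)
    fix R S :: real assume "R \<le> S"
    show "gamma_thin_bdd (?Z R) \<le> gamma_thin_bdd (?Z S)"
      by (rule thin(4), rule thin(1)) (auto intro: anti[OF \<open>R \<le> S\<close>])
  qed
  have mono_I: "mono (\<lambda>R. I_bdd \<alpha> \<alpha> (?Z R))" if "\<alpha> \<le> 1" for \<alpha>
  proof (rule monoI)
    fix R S :: real assume "R \<le> S"
    show "I_bdd \<alpha> \<alpha> (?Z R) \<le> I_bdd \<alpha> \<alpha> (?Z S)"
      by (rule I_bdd_greatest[OF trunc], rule I_bdd_lower[OF that that])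
         (auto intro: anti[OF \<open>R \<le> S\<close>])
  qed
  \<comment> \<open>Finite area bounds all truncations at once; with monotonicity this makes the
    limits exist.\<close>
  have thin_bdd: "gamma_thin_bdd (?Z R) \<le> measure lborel Z + 1" for R
  proof -
    have "measure lborel (?Z R) \<le> measure lborel Z"
      using assms(2) Zcl cl
      by (intro measure_mono_fmeasurable) (auto simp: fmeasurable_def borel_closed)
    then show ?thesis using thin(2)[of R] by linarith
  qed
  have I_bdd_le: "I_bdd \<alpha> \<alpha> (?Z R) \<le> measure lborel Z + 1" if "0 \<le> \<alpha>" "\<alpha> \<le> 1" for \<alpha> R
  proof -
    have "I_bdd \<alpha> \<alpha> (?Z R) \<le> gamma_thin_bdd (?Z R) * (1 - \<alpha>)" by (rule I(2)[OF that])
    also have "\<dots> \<le> gamma_thin_bdd (?Z R)"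
      using that thin(3)[of R] by (intro mult_right_le_one_le) auto
    finally show ?thesis using thin_bdd[of R] by linarith
  qed
  have lim_thin: "((\<lambda>R. gamma_thin_bdd (?Z R)) \<longlongrightarrow> gamma_thin_E Z) at_top"
    unfolding gamma_thin_E_def by (rule tendsto_Lim_mono_bounded[OF mono_thin thin_bdd])
  have lim_I: "((\<lambda>R. I_bdd \<alpha> \<alpha> (?Z R)) \<longlongrightarrow> I_E \<alpha> \<alpha> Z) at_top" if "0 \<le> \<alpha>" "\<alpha> \<le> 1" for \<alpha>
    unfolding I_E_def using that
    by (intro tendsto_Lim_mono_bounded[OF mono_I I_bdd_le]) auto
  have thin_nonneg: "0 \<le> gamma_thin_E Z"
    by (rule tendsto_lowerbound[OF lim_thin]) (auto simp: thin(3))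
  have I_nonneg: "0 \<le> I_E \<alpha> \<alpha> Z" if "0 \<le> \<alpha>" "\<alpha> \<le> 1" for \<alpha>
    by (rule tendsto_lowerbound[OF lim_I[OF that]]) (auto simp: I(1)[OF that])
  have upper: "I_E \<alpha> \<alpha> Z \<le> gamma_thin_E Z * (1 - \<alpha>)" if "0 \<le> \<alpha>" "\<alpha> \<le> 1" for \<alpha>
    by (rule tendsto_le[OF _ tendsto_mult_right[OF lim_thin] lim_I[OF that]])
       (auto simp: I(2)[OF that])
  have scale: "(1 - \<alpha>) * gamma_E Z \<le> I_E \<alpha> \<alpha> Z" if "0 \<le> \<alpha>" "\<alpha> \<le> 1" for \<alpha>
    unfolding gamma_E_def
    by (rule tendsto_le[OF _ lim_I[OF that] tendsto_mult_left[OF lim_I]])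
       (auto simp: I(3)[OF that])
  have half: "gamma_thin_E Z * (1 - \<alpha>) \<le> I_E \<alpha> \<alpha> Z" if "1 / 2 \<le> \<alpha>" "\<alpha> \<le> 1" for \<alpha>
  proof -
    have \<alpha>: "0 \<le> \<alpha>" using that by simp
    show ?thesis
      by (rule tendsto_le[OF _ lim_I[OF \<alpha> that(2)] tendsto_mult_right[OF lim_thin]])
         (auto simp: I(4)[OF \<alpha> that(2,1)])
  qed
  have lower_bound: "gamma_thin_E Z * ((1 - \<alpha>) - 2 * (1 - \<alpha>)^2) \<le> I_E \<alpha> \<alpha> Z"
    if "0 \<le> \<alpha>" "\<alpha> \<le> 1" for \<alpha>
  proof (cases "1 / 2 \<le> \<alpha>")
    case True
    have "gamma_thin_E Z * ((1 - \<alpha>) - 2 * (1 - \<alpha>)^2) \<le> gamma_thin_E Z * (1 - \<alpha>)"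
      by (intro mult_left_mono thin_nonneg) simp
    then show ?thesis using half[OF True that(2)] by linarith
  next
    case False
    have "(1 - \<alpha>) - 2 * (1 - \<alpha>)^2 = (1 - \<alpha>) * (2 * \<alpha> - 1)"
      by (simp add: power2_eq_square algebra_simps)
    also have "\<dots> \<le> 0" using False that by (intro mult_nonneg_nonpos) auto
    finally have "gamma_thin_E Z * ((1 - \<alpha>) - 2 * (1 - \<alpha>)^2) \<le> 0"
      using thin_nonneg by (simp add: mult_nonneg_nonpos)
    then show ?thesis using I_nonneg[OF that] by linarith
  qed
  have "gamma_E Z \<le> gamma_thin_E Z" using upper[of 0] by (simp add: gamma_E_def)
  \<comment> \<open>At \<open>\<alpha> = 1/2\<close> the bound \<open>half\<close> compares half of
    \<open>gamma_thin_E Z\<close> with half of \<open>gamma_E Z\<close>, so linearity at this single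
    value suffices.\<close>
  moreover have "gamma_thin_E Z \<le> gamma_E Z"
    if "\<forall>\<alpha>. 0 \<le> \<alpha> \<and> \<alpha> \<le> 1 \<longrightarrow> I_E \<alpha> \<alpha> Z = (1 - \<alpha>) * gamma_E Z"
    using half[of "1 / 2"] that[rule_format, of "1 / 2"] by simp
  \<comment> \<open>When the two constants agree, \<open>upper\<close> and \<open>scale\<close>
    squeeze \<open>I_E\<close> between equal bounds.\<close>
  moreover have "I_E \<alpha> \<alpha> Z = (1 - \<alpha>) * gamma_E Z"
    if "gamma_thin_E Z = gamma_E Z" "0 \<le> \<alpha>" "\<alpha> \<le> 1" for \<alpha>
    using upper[OF that(2,3)] scale[OF that(2,3)] that(1) by (simp add: mult.commute)
  ultimately show ?thesis using upper lower_bound by (auto intro: antisym)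
qed

end
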